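(* Consider the plant $x_{t+1}=Ax_t+Bu_t+w_{t+1}$, $x_0=w_0$, with $A\in\mathbb{R}^{n\times n}$ stable and $B\in\mathbb{R}^{n\times m}$, where the $w_t$ are i.i.d. Gaussian with mean $\mathbf{0}$ and variance $\sigma_w^2I$ ($\sigma_w^2>0$), and the inputs $u_t=a_t$, $t=0,\dots,j$, are i.i.d. Gaussian with mean $\mathbf{0}$ and variance $\sigma_u^2I$. Let $\Psi_1$ and $\Psi_2$ be the solutions of the discrete Lyapunov equations $A\Psi_1A^\top-\Psi_1+BB^\top=O$ and $A\Psi_2A^\top-\Psi_2+I=O$. With $N=j+1$, let $\gamma(N)$ be the sample identifying complexity of the plant under least squares identification, i.e. the lower bound $$\gamma(N)=\frac{(m+n)\,\sigma_w^2}{j\left(m+\operatorname{tr}(\Psi_1)\right)\sigma_u^2+\left(jn+\operatorname{tr}(\Psi_2)\right)\sigma_w^2}$$ on the expected estimation error $\mathbb{E}[\epsilon]$. Let $R_\sigma=\sigma_u^2/\sigma_w^2$. Suppose $j$ is sufficiently large. Then the sample identifying complexity is given as $$\gamma(N)=\frac{m+n}{j\left[(m+\operatorname{tr}(\Psi_1))R_\sigma+n\right]}.$$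
   Context: The state $x_t$ is in $\mathbb{R}^n$ and the input $u_t$ in $\mathbb{R}^m$; "stable" is in the discrete-time sense (all eigenvalues of $A$ have modulus less than $1$). An adversary obtains the $N=j+1$ samples $\{(u_k,x_k)\}_{k=0}^{j}$ and computes the least squares estimate $[\hat A\ \hat B]=X_f\,([X_p^\top\ U_p^\top]^\top)^+$, where $X_p=[x_0\cdots x_{j-1}]$, $X_f=[x_1\cdots x_j]$, $U_p=[u_0\cdots u_{j-1}]$ and $^+$ is the pseudo-inverse. The estimation error is $\epsilon=\frac{1}{n(n+m)}\left\|[A\ B]-[\hat A\ \hat B]\right\|_F^2$. A sample identifying complexity is a function $\gamma$ with $\gamma(N)\le\mathbb{E}[\epsilon]$ for sample size $N$. The paper introduces the simplified formula by saying that, for sufficiently large $j$, $\gamma$ can be approximated by it; the justification is that the denominator of the first expression for $\gamma(N)$ is then approximated by $j(m+\operatorname{tr}(\Psi_1))\sigma_u^2+jn\sigma_w^2$.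
   Formalization: The final equality, which fails for every finite j since tr(Ψ₂)>0, is read as asymptotic equivalence as j→∞; the lower bound on E[ε] passes to (1−δ) times the simplified formula, for each δ>0 and all large j. *)

theory Defs
  imports
    "HOL-Probability.Probability"
    "HOL-Library.Landau_Symbols"
    "Jordan_Normal_Form.Char_Poly"
begin

unbundle no vec_syntax
no_notation inner (infix "\<bullet>" 70)
hide_const (open) Finite_Cartesian_Product.vec Finite_Cartesian_Product.mat
  Determinants.det Finite_Cartesian_Product.row Finite_Cartesian_Product.transpose
hide_type (open) Finite_Cartesian_Product.vec

definition append_cols :: "'a::zero mat \<Rightarrow> 'a mat \<Rightarrow> 'a mat" (infixr "@\<^sub>c" 65) where
  "A @\<^sub>c B = four_block_mat A B (0\<^sub>m 0 (dim_col A)) (0\<^sub>m 0 (dim_col B))"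

definition mat_trace :: "'a::comm_monoid_add mat \<Rightarrow> 'a" where
  "mat_trace A = (\<Sum>i<dim_row A. A $$ (i, i))"

definition frobenius_sq :: "real mat \<Rightarrow> real" where
  "frobenius_sq A = (\<Sum>i<dim_row A. \<Sum>k<dim_col A. (A $$ (i, k))\<^sup>2)"

text \<open>The Moore--Penrose inverse: every real matrix has exactly one matrix satisfying the
  four Penrose equations.\<close>

definition is_pseudo_inverse :: "real mat \<Rightarrow> real mat \<Rightarrow> bool" where
  "is_pseudo_inverse Z P \<longleftrightarrow>
     P \<in> carrier_mat (dim_col Z) (dim_row Z) \<and>
     Z * P * Z = Z \<and> P * Z * P = P \<and>
     transpose_mat (Z * P) = Z * P \<and> transpose_mat (P * Z) = P * Z"

definition pseudo_inverse :: "real mat \<Rightarrow> real mat" where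
  "pseudo_inverse Z = (THE P. is_pseudo_inverse Z P)"

definition schur_stable :: "real mat \<Rightarrow> bool" where
  "schur_stable A \<longleftrightarrow> (\<forall>z. eigenvalue (map_mat complex_of_real A) z \<longrightarrow> cmod z < 1)"

text \<open>The Gaussian law on the reals with mean \<open>\<mu>\<close> and variance \<open>\<sigma>\<^sup>2\<close>; for \<open>\<sigma> = 0\<close> it is the
  point mass at \<open>\<mu>\<close>, which has no Lebesgue density.\<close>

definition gaussian_law :: "real \<Rightarrow> real \<Rightarrow> real measure" where
  "gaussian_law \<mu> \<sigma> =
     (if \<sigma> = 0 then return borel \<mu> else density lborel (\<lambda>s. ennreal (normal_density \<mu> \<sigma> s)))"

text \<open>An i.i.d. sequence of \<open>d\<close>-dimensional \<open>N(0, \<sigma>\<^sup>2 I)\<close> vectors. Since the covariance is a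
  multiple of the identity, this means that all scalar components, over all times and all
  coordinates together, are independent with law \<open>N(0, \<sigma>\<^sup>2)\<close>.\<close>

definition iid_gaussian_vectors ::
    "'w measure \<Rightarrow> nat \<Rightarrow> real \<Rightarrow> (nat \<Rightarrow> 'w \<Rightarrow> real vec) \<Rightarrow> bool" where
  "iid_gaussian_vectors M d \<sigma> z \<longleftrightarrow>
     (\<forall>t. \<forall>\<omega>\<in>space M. z t \<omega> \<in> carrier_vec d) \<and>
     prob_space.indep_vars M (\<lambda>_. borel) (\<lambda>(t, i) \<omega>. z t \<omega> $ i) (UNIV \<times> {..<d}) \<and>
     (\<forall>t. \<forall>i<d. distr M borel (\<lambda>\<omega>. z t \<omega> $ i) = gaussian_law 0 \<sigma>)"

text \<open>Least squares identification of \<open>[A B]\<close>, of size \<open>n \<times> (n + m)\<close>, from the state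
  trajectory \<open>x\<^sub>0, \<dots>, x\<^sub>j\<close> and the input trajectory \<open>u\<^sub>0, \<dots>, u\<^sub>j\<close>.\<close>

definition ls_estimate ::
    "nat \<Rightarrow> nat \<Rightarrow> (nat \<Rightarrow> real vec) \<Rightarrow> (nat \<Rightarrow> real vec) \<Rightarrow> nat \<Rightarrow> real mat" where
  "ls_estimate n m x u j =
     (let Xp = mat_of_cols n (map x [0..<j]);
          Xf = mat_of_cols n (map x [1..<j + 1]);
          Up = mat_of_cols m (map u [0..<j])
      in Xf * pseudo_inverse (Xp @\<^sub>r Up))"

definition estimation_error ::
    "real mat \<Rightarrow> real mat \<Rightarrow> (nat \<Rightarrow> real vec) \<Rightarrow> (nat \<Rightarrow> real vec) \<Rightarrow> nat \<Rightarrow> real" where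
  "estimation_error A B x u j =
     (let n = dim_row A; m = dim_col B
      in frobenius_sq ((A @\<^sub>c B) - ls_estimate n m x u j) / (real n * (real n + real m)))"

text \<open>\<open>c\<close> is an admissible value, at sample size \<open>N\<close>, of a sample identifying complexity:
  \<open>c \<le> E[\<epsilon>]\<close>. With \<open>N\<close> samples the last time index is \<open>j = N - 1\<close>. The expectation of the
  nonnegative error is the extended-real one, as it is infinite for some small \<open>N\<close> (where the
  Bochner integral would be \<open>0\<close>).\<close>

definition sample_identifying_complexity ::
    "'w measure \<Rightarrow> real mat \<Rightarrow> real mat \<Rightarrow> (nat \<Rightarrow> 'w \<Rightarrow> real vec) \<Rightarrow> (nat \<Rightarrow> 'w \<Rightarrow> real vec) \<Rightarrow>
     nat \<Rightarrow> real \<Rightarrow> bool" where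
  "sample_identifying_complexity M A B x u N c \<longleftrightarrow>
     ennreal c \<le> (\<integral>\<^sup>+\<omega>. ennreal (estimation_error A B (\<lambda>t. x t \<omega>) (\<lambda>t. u t \<omega>) (N - 1)) \<partial>M)"

end

(* Dividing by \<sigma>w\<^sup>2, \<gamma>(j + 1) = (m + n) / (j D + tr \<Psi>2) with D = (m + tr \<Psi>1) R\<sigma> + n, so everything
   reduces to D > 0, i.e. to tr \<Psi>1 \<ge> 0. By the Lyapunov equation, tr (A^k \<Psi>1 (A^k)^T) decreases in k
   (each step subtracts the squared Frobenius norm of A^k B), and it tends to 0 because A is stable. *)

theory Submission
  imports Defs "Jordan_Normal_Form.Spectral_Radius" "HOL-Real_Asymp.Real_Asymp"
begin

lemma smult_pow_mat:
  assumes "A \<in> carrier_mat n n"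
  shows "(c \<cdot>\<^sub>m A) ^\<^sub>m k = (c ^ k :: 'a::comm_semiring_1) \<cdot>\<^sub>m (A ^\<^sub>m k)"
proof (induction k)
  case 0
  show ?case by (intro eq_matI) auto
next
  case (Suc k)
  have P: "A ^\<^sub>m k \<in> carrier_mat n n"
    using assms by simp
  have "(c \<cdot>\<^sub>m A) ^\<^sub>m Suc k = (c ^ k \<cdot>\<^sub>m (A ^\<^sub>m k)) * (c \<cdot>\<^sub>m A)"
    using Suc by simp
  also have "\<dots> = c ^ Suc k \<cdot>\<^sub>m (A ^\<^sub>m k * A)"
    using P assms by (intro eq_matI) (auto simp: scalar_prod_def sum_distrib_left mult_ac)
  finally show ?case by simp
qed

lemma eigenvalue_smult_divide:
  fixes A :: "'a::field mat"
  assumes A: "A \<in> carrier_mat n n" and c: "c \<noteq> 0" and ev: "eigenvalue (c \<cdot>\<^sub>m A) z"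
  shows "eigenvalue A (z / c)"
proof -
  obtain v where v: "v \<in> carrier_vec n" "v \<noteq> 0\<^sub>v n" "(c \<cdot>\<^sub>m A) *\<^sub>v v = z \<cdot>\<^sub>v v"
    using ev A unfolding eigenvalue_def eigenvector_def by auto
  have "c * (row A i \<bullet> v) = z * v $ i" if "i < n" for i
  proof -
    have "c * (row A i \<bullet> v) = ((c \<cdot>\<^sub>m A) *\<^sub>v v) $ i"
      using that A v(1) by (simp add: scalar_prod_def sum_distrib_left mult_ac)
    then show ?thesis using that v(1,3) by simp
  qed
  then have "A *\<^sub>v v = (z / c) \<cdot>\<^sub>v v"
    using A v(1) c by (intro eq_vecI) (auto simp: field_simps)
  then show ?thesis
    using A v unfolding eigenvalue_def eigenvector_def by auto
qed

text \<open>Holds because the spectral radius is strictly below 1. Convergence is stated entrywise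
  so that it passes through the finite sums of products of entries that make up a trace.\<close>

lemma schur_stable_power_tendsto_0:
  assumes A: "A \<in> carrier_mat n n" and st: "schur_stable A" and i: "i < n" and l: "l < n"
  shows "(\<lambda>k. (A ^\<^sub>m k) $$ (i, l)) \<longlonglongrightarrow> 0"
proof -
  define C where "C = map_mat complex_of_real A"
  have C: "C \<in> carrier_mat n n" using A by (simp add: C_def)
  have n: "n \<noteq> 0" using i by simp
  define \<rho> where "\<rho> = spectral_radius C"
  \<comment> \<open>For \<open>n\<close> > 0 the spectral radius is attained at an eigenvalue, so
    strictness for each eigenvalue survives the maximum.\<close>
  obtain z where "z \<in> spectrum C" "\<rho> = norm z"
    using spectral_radius_mem_max(1)[OF C] n unfolding \<rho>_def by auto
  then have \<rho>: "0 \<le> \<rho>" "\<rho> < 1"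
    using st unfolding schur_stable_def spectrum_def C_def by auto
  \<comment> \<open>The library only bounds the powers of a matrix of spectral radius below 1. Apply this to
    \<open>A / r\<close> with \<open>r\<close> between the spectral radius and 1 to get geometric decay.\<close>
  define r where "r = (1 + \<rho>) / 2"
  have r: "0 < r" "r < 1" "\<rho> < r" using \<rho> by (auto simp: r_def)
  define c where "c = complex_of_real (1 / r)"
  have c: "c \<noteq> 0" using r by (simp add: c_def)
  have cC: "c \<cdot>\<^sub>m C \<in> carrier_mat n n" using C by simp
  obtain y where y: "y \<in> spectrum (c \<cdot>\<^sub>m C)" "spectral_radius (c \<cdot>\<^sub>m C) = norm y"
    using spectral_radius_mem_max(1)[OF cC] n by auto
  \<comment> \<open>An eigenvalue \<open>y\<close> of largest modulus of the rescaled matrix is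
    pulled back to \<open>C\<close>. As \<open>c\<close> = 1/\<open>r\<close>, this gives
    |\<open>y\<close>| \<open>r\<close> \<le> \<open>\<rho>\<close> < \<open>r\<close>.\<close>
  have "y / c \<in> spectrum C"
    using y(1) eigenvalue_smult_divide[OF C c] by (simp add: spectrum_def)
  then have "norm (y / c) \<le> \<rho>"
    using spectral_radius_mem_max(2)[OF C] n unfolding \<rho>_def by auto
  then have "norm y * r \<le> \<rho>" using r by (simp add: c_def norm_divide norm_mult)
  then have "norm y * r < 1 * r" using r by linarith
  then have "norm y < 1" using r(1) by (metis mult_less_cancel_right_pos)
  then obtain b where b: "\<And>k. norm_bound ((c \<cdot>\<^sub>m C) ^\<^sub>m k) b"
    using spectral_radius_jnf_norm_bound_less_1_upper_triangular[OF cC] y(2) by auto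
  have bound: "norm ((A ^\<^sub>m k) $$ (i, l)) \<le> b * r ^ k" for k
  proof -
    \<comment> \<open>Real powers are compared with powers of the rescaled complex matrix; the
      factor \<open>c ^ k\<close> is the inverse of \<open>r ^ k\<close>.\<close>
    have "C ^\<^sub>m k = map_mat complex_of_real (A ^\<^sub>m k)"
      unfolding C_def by (rule of_real_hom.mat_hom_pow[OF A, symmetric])
    then have "((c \<cdot>\<^sub>m C) ^\<^sub>m k) $$ (i, l) = c ^ k * complex_of_real ((A ^\<^sub>m k) $$ (i, l))"
      using A i l by (simp add: smult_pow_mat[OF C])
    moreover have "norm (((c \<cdot>\<^sub>m C) ^\<^sub>m k) $$ (i, l)) \<le> b"
      using b[of k] i l carrier_matD[OF pow_carrier_mat[OF cC, of k]]
      unfolding norm_bound_def by metis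
    ultimately have "norm (c ^ k * complex_of_real ((A ^\<^sub>m k) $$ (i, l))) \<le> b"
      by simp
    then show ?thesis
      using r by (simp add: c_def norm_mult norm_power norm_divide power_one_over field_simps)
  qed
  have "(\<lambda>k. b * r ^ k) \<longlonglongrightarrow> 0"
    using r by (intro tendsto_mult_right_zero LIMSEQ_power_zero) auto
  then show ?thesis
    by (rule Lim_null_comparison[rotated]) (use bound in auto)
qed

lemma mat_trace_minus:
  fixes X Y :: "real Matrix.mat"
  assumes "X \<in> carrier_mat n n" and "Y \<in> carrier_mat n n"
  shows "mat_trace (X - Y) = mat_trace X - mat_trace Y"
  using assms by (simp add: mat_trace_def sum_subtractf)

lemma mat_trace_mult_transpose_nonneg:
  fixes X :: "real Matrix.mat"
  shows "0 \<le> mat_trace (X * transpose_mat X)"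
  by (auto simp: mat_trace_def scalar_prod_def intro!: sum_nonneg)

text \<open>Exposes the diagonal as a polynomial in the entries of \<open>P\<close>, so that
  entrywise limits of \<open>P\<close> carry over.\<close>

lemma congruence_diag_eq_sum:
  fixes P \<Psi> :: "real Matrix.mat"
  assumes "P \<in> carrier_mat n n" and "\<Psi> \<in> carrier_mat n n" and "i < n"
  shows "(P * \<Psi> * transpose_mat P) $$ (i, i) =
    (\<Sum>p<n. \<Sum>q<n. P $$ (i, p) * \<Psi> $$ (p, q) * P $$ (i, q))"
  using assms by (simp add: scalar_prod_def sum_distrib_left atLeast0LessThan mult.assoc)

text \<open>In effect \<open>\<Psi>\<close> is the sum of A^k B B^T (A^k)^T over k, whose terms have
  nonnegative trace; monotonicity and a limit replace the summation.\<close>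

lemma lyapunov_trace_nonneg:
  fixes A B \<Psi> :: "real Matrix.mat"
  assumes A: "A \<in> carrier_mat n n" and B: "B \<in> carrier_mat n m" and \<Psi>: "\<Psi> \<in> carrier_mat n n"
    and st: "schur_stable A"
    and lyap: "A * \<Psi> * transpose_mat A - \<Psi> + B * transpose_mat B = 0\<^sub>m n n"
  shows "0 \<le> mat_trace \<Psi>"
proof -
  define T where "T k = mat_trace (A ^\<^sub>m k * \<Psi> * transpose_mat (A ^\<^sub>m k))" for k
  have step: "T (Suc k) \<le> T k" for k
  proof -
    define P where "P = A ^\<^sub>m k"
    have P: "P \<in> carrier_mat n n" using A by (simp add: P_def)
    note c = A B \<Psi> P
    have eq: "A * \<Psi> * transpose_mat A = \<Psi> - B * transpose_mat B" (is "?L = ?R")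
    proof (rule eq_matI)
      fix i l assume "i < dim_row ?R" "l < dim_col ?R"
      then show "?L $$ (i, l) = ?R $$ (i, l)"
        using arg_cong[OF lyap, of "\<lambda>X. X $$ (i, l)"] c by simp
    qed (use c in auto)
    \<comment> \<open>Conjugating the Lyapunov equation by \<open>P\<close> turns B B^T into the
      Gram matrix of the rows of \<open>P * B\<close>.\<close>
    have "P * A * \<Psi> * transpose_mat (P * A) = P * (A * \<Psi> * transpose_mat A) * transpose_mat P"
      using c by (simp add: transpose_mult[of _ n n _ n] assoc_mult_mat[of _ n n _ n _ n])
    also have "\<dots> = (P * \<Psi> - P * (B * transpose_mat B)) * transpose_mat P"
      unfolding eq using c by (subst mult_minus_distrib_mat[of _ n n]) auto
    also have "\<dots> = P * \<Psi> * transpose_mat P - P * (B * transpose_mat B) * transpose_mat P"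
      using c by (subst minus_mult_distrib_mat[of _ n n]) auto
    also have "P * (B * transpose_mat B) * transpose_mat P = (P * B) * transpose_mat (P * B)"
    proof -
      have tB: "transpose_mat B \<in> carrier_mat m n" and tP: "transpose_mat P \<in> carrier_mat n n"
        using c by auto
      have PB: "P * B \<in> carrier_mat n m"
        using c by auto
      show ?thesis
        unfolding transpose_mult[OF P B] assoc_mult_mat[OF P B tB, symmetric]
        by (rule assoc_mult_mat[OF PB tB tP])
    qed
    finally have PA: "P * A * \<Psi> * transpose_mat (P * A) =
      P * \<Psi> * transpose_mat P - (P * B) * transpose_mat (P * B)" .
    have "T (Suc k) = T k - mat_trace ((P * B) * transpose_mat (P * B))"
      unfolding T_def pow_mat.simps P_def[symmetric] PA
      by (rule mat_trace_minus[of _ n]) (use c in auto)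
    then show ?thesis using mat_trace_mult_transpose_nonneg[of "P * B"] by simp
  qed
  have le: "T k \<le> mat_trace \<Psi>" for k
  proof -
    have "T k \<le> T 0" by (rule lift_Suc_antimono_le[of T]) (auto simp: step)
    also have "T 0 = mat_trace \<Psi>" using A \<Psi> by (simp add: T_def)
    finally show ?thesis .
  qed
  have "T = (\<lambda>k. \<Sum>i<n. \<Sum>p<n. \<Sum>q<n.
      (A ^\<^sub>m k) $$ (i, p) * \<Psi> $$ (p, q) * (A ^\<^sub>m k) $$ (i, q))"
  proof
    fix k
    have "A ^\<^sub>m k \<in> carrier_mat n n" using A by simp
    then show "T k = (\<Sum>i<n. \<Sum>p<n. \<Sum>q<n.
        (A ^\<^sub>m k) $$ (i, p) * \<Psi> $$ (p, q) * (A ^\<^sub>m k) $$ (i, q))"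
      unfolding T_def mat_trace_def using A \<Psi>
      by (intro sum.cong congruence_diag_eq_sum) auto
  qed
  moreover have "(\<lambda>k. \<Sum>i<n. \<Sum>p<n. \<Sum>q<n.
      (A ^\<^sub>m k) $$ (i, p) * \<Psi> $$ (p, q) * (A ^\<^sub>m k) $$ (i, q)) \<longlonglongrightarrow> 0"
    using schur_stable_power_tendsto_0[OF A st]
    by (intro tendsto_null_sum tendsto_mult_zero tendsto_mult_left_zero) auto
  ultimately have "T \<longlonglongrightarrow> 0" by simp
  \<comment> \<open>\<open>mat_trace \<Psi>\<close> bounds from above a sequence with limit
    0.\<close>
  then show ?thesis by (rule LIMSEQ_le_const2) (use le in auto)
qed

text \<open>"Sufficiently large j" is read asymptotically: the ratio of the two formulas tends to 1.
  The second conjunct transfers the lower bound property from \<open>\<gamma>\<close> to the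
  simplified value. The factor \<open>1 - \<delta>\<close> absorbs the dropped trace of
  \<open>\<Psi>2\<close>, which is positive, so that the simplified value slightly exceeds
  \<open>\<gamma>\<close>.\<close>

theorem corollary1:
  fixes M :: "'w measure"
    and n m :: nat
    and A B \<Psi>1 \<Psi>2 :: "real Matrix.mat"
    and w u x :: "nat \<Rightarrow> 'w \<Rightarrow> real Matrix.vec"
    and \<sigma>w \<sigma>u R\<sigma> :: real
    and \<gamma> :: "nat \<Rightarrow> real"
  assumes "prob_space M"
    and "n \<ge> 1"
    and "A \<in> carrier_mat n n" and "B \<in> carrier_mat n m"
    and "schur_stable A"
    and "\<sigma>w > 0" and "\<sigma>u \<ge> 0"
    and "iid_gaussian_vectors M n \<sigma>w w"
    and "iid_gaussian_vectors M m \<sigma>u u"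
    and "\<And>\<omega>. \<omega> \<in> space M \<Longrightarrow> x 0 \<omega> = w 0 \<omega>"
    and "\<And>t \<omega>. \<omega> \<in> space M \<Longrightarrow>
           x (t + 1) \<omega> = A *\<^sub>v x t \<omega> + B *\<^sub>v u t \<omega> + w (t + 1) \<omega>"
    and "\<Psi>1 \<in> carrier_mat n n"
    and "A * \<Psi>1 * transpose_mat A - \<Psi>1 + B * transpose_mat B = 0\<^sub>m n n"
    and "\<Psi>2 \<in> carrier_mat n n"
    and "A * \<Psi>2 * transpose_mat A - \<Psi>2 + 1\<^sub>m n = 0\<^sub>m n n"
    and "\<And>j. j \<ge> 1 \<Longrightarrow> \<gamma> (j + 1) =
           (real m + real n) * \<sigma>w\<^sup>2 /
           (real j * (real m + mat_trace \<Psi>1) * \<sigma>u\<^sup>2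
            + (real j * real n + mat_trace \<Psi>2) * \<sigma>w\<^sup>2)"
    and "R\<sigma> = \<sigma>u\<^sup>2 / \<sigma>w\<^sup>2"
  shows "(\<lambda>j. \<gamma> (j + 1)) \<sim>[sequentially]
           (\<lambda>j. (real m + real n) / (real j * ((real m + mat_trace \<Psi>1) * R\<sigma> + real n)))
         \<and> (\<forall>\<delta>>0. \<forall>\<^sub>F j in sequentially.
              sample_identifying_complexity M A B x u (j + 1) (\<gamma> (j + 1)) \<longrightarrow>
              sample_identifying_complexity M A B x u (j + 1)
                ((1 - \<delta>) * ((real m + real n) /
                   (real j * ((real m + mat_trace \<Psi>1) * R\<sigma> + real n)))))"
proof -
  define D where "D = (real m + mat_trace \<Psi>1) * R\<sigma> + real n"
  define t where "t j = (real m + real n) / (real j * D)" for j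
  have "0 \<le> mat_trace \<Psi>1"
    using assms(3,4,5,12,13) by (intro lyapunov_trace_nonneg[of A n B m])
  \<comment> \<open>Strictness comes from n \<ge> 1, which also covers zero input variance, where
    \<open>R\<sigma>\<close> = 0.\<close>
  then have D: "D > 0"
    using assms(2,6,17) unfolding D_def by (intro add_nonneg_pos mult_nonneg_nonneg) auto
  have \<gamma>: "\<gamma> (j + 1) = (real m + real n) / (real j * D + mat_trace \<Psi>2)" if "j \<ge> 1" for j
  proof -
    have "\<sigma>u\<^sup>2 = R\<sigma> * \<sigma>w\<^sup>2" using assms(6,17) by simp
    then have "real j * (real m + mat_trace \<Psi>1) * \<sigma>u\<^sup>2 + (real j * real n + mat_trace \<Psi>2) * \<sigma>w\<^sup>2
        = (real j * D + mat_trace \<Psi>2) * \<sigma>w\<^sup>2"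
      by (simp add: D_def algebra_simps)
    then show ?thesis using assms(16)[OF that] assms(6) by simp
  qed
  \<comment> \<open>Since \<open>D\<close> > 0, the linear term outgrows the constant trace of
    \<open>\<Psi>2\<close>.\<close>
  have "(\<lambda>j. real j * D / (real j * D + mat_trace \<Psi>2)) \<longlonglongrightarrow> 1"
    using D by real_asymp
  moreover have "\<forall>\<^sub>F j in sequentially.
      real j * D / (real j * D + mat_trace \<Psi>2) = \<gamma> (j + 1) / t j"
    using eventually_ge_at_top[of 1]
  proof eventually_elim
    case (elim j)
    then show ?case using assms(2) D by (simp add: \<gamma>[OF elim] t_def del: Suc_eq_plus1 One_nat_def add_Suc_right)
  qed
  ultimately have lim: "(\<lambda>j. \<gamma> (j + 1) / t j) \<longlonglongrightarrow> 1"
    by (rule Lim_transform_eventually)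
  have pos: "\<forall>\<^sub>F j in sequentially. t j > 0"
    using eventually_ge_at_top[of 1]
    by eventually_elim (use assms(2) D in \<open>auto simp: t_def intro!: divide_pos_pos mult_pos_pos\<close>)
  have "(\<lambda>j. \<gamma> (j + 1)) \<sim>[sequentially] t"
    using pos by (intro asymp_equivI'[OF lim]) 
  moreover have "\<forall>\<^sub>F j in sequentially.
      sample_identifying_complexity M A B x u (j + 1) (\<gamma> (j + 1)) \<longrightarrow>
      sample_identifying_complexity M A B x u (j + 1) ((1 - \<delta>) * t j)" if "\<delta> > 0" for \<delta>
  proof -
    have "\<forall>\<^sub>F j in sequentially. 1 - \<delta> < \<gamma> (j + 1) / t j"
      using that by (intro order_tendstoD(1)[OF lim]) auto
    with pos show ?thesis
    proof eventually_elim
      case (elim j)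
      \<comment> \<open>Anything below an admissible value is admissible; for
        \<open>\<delta>\<close> > 1 the left side is negative and \<open>ennreal\<close> sends it to
        0.\<close>
      then have "(1 - \<delta>) * t j \<le> \<gamma> (j + 1)" by (simp add: field_simps)
      then show ?case
        unfolding sample_identifying_complexity_def using ennreal_leI order_trans by blast
    qed
  qed
  ultimately show ?thesis unfolding t_def D_def by blast
qed

end
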